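(* Let $\epsilon>0$ and $1\le\alpha<1+\frac{1}{\epsilon}$. Then there exist an undirected graph $G=(V,E)$, edge weights $c:E\to\mathbb{R}_{>0}$ and a vertex $r\in V$ with the following properties: - $\mathrm{dist}_{(G,c)}(r,v)\le1$ for all $v\in V$; - every spanning tree $F$ of $G$ in which every path from $r$ has length at most $1+\epsilon$ has total length greater than $\alpha\cdot\mathrm{MST}$, where $\mathrm{MST}$ is the length of a minimum spanning tree of $(G,c)$. *)

theory Defs
  imports Complex_Main "HOL-Library.Extended_Real"
begin

text \<open>Graphs are finite and simple. An edge is the two-element set of its end vertices.\<close>

definition undirected_graph :: "'a set \<Rightarrow> 'a set set \<Rightarrow> bool" where
  "undirected_graph V E \<longleftrightarrow> finite V \<and> (\<forall>e\<in>E. e \<subseteq> V \<and> card e = 2)"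

text \<open>A path is given by its nonempty list of pairwise distinct vertices; a single vertex is a path
  without edges.\<close>

definition graph_path :: "'a set \<Rightarrow> 'a set set \<Rightarrow> 'a list \<Rightarrow> bool" where
  "graph_path V E p \<longleftrightarrow>
     p \<noteq> [] \<and> set p \<subseteq> V \<and> distinct p \<and> successively (\<lambda>u v. {u, v} \<in> E) p"

definition path_edges :: "'a list \<Rightarrow> 'a set list" where
  "path_edges p = map (\<lambda>(u, v). {u, v}) (zip p (tl p))"

definition path_length :: "('a set \<Rightarrow> real) \<Rightarrow> 'a list \<Rightarrow> real" where
  "path_length c p = sum_list (map c (path_edges p))"

text \<open>The distance is extended real valued, so that it is infinite (the infimum of the empty set)
  if no path exists.\<close>

definition graph_dist :: "'a set \<Rightarrow> 'a set set \<Rightarrow> ('a set \<Rightarrow> real) \<Rightarrow> 'a \<Rightarrow> 'a \<Rightarrow> ereal" where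
  "graph_dist V E c u v =
     (INF p\<in>{p. graph_path V E p \<and> hd p = u \<and> last p = v}. ereal (path_length c p))"

definition graph_connected :: "'a set \<Rightarrow> 'a set set \<Rightarrow> bool" where
  "graph_connected V E \<longleftrightarrow>
     V \<noteq> {} \<and> (\<forall>u\<in>V. \<forall>v\<in>V. \<exists>p. graph_path V E p \<and> hd p = u \<and> last p = v)"

text \<open>A cycle is given by the path obtained from it by deleting one edge.\<close>

definition graph_cycle :: "'a set \<Rightarrow> 'a set set \<Rightarrow> 'a list \<Rightarrow> bool" where
  "graph_cycle V E p \<longleftrightarrow> graph_path V E p \<and> length p \<ge> 3 \<and> {last p, hd p} \<in> E"

definition graph_tree :: "'a set \<Rightarrow> 'a set set \<Rightarrow> bool" where
  "graph_tree V E \<longleftrightarrow>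
     undirected_graph V E \<and> graph_connected V E \<and> (\<nexists>p. graph_cycle V E p)"

text \<open>A spanning tree of \<open>(V, E)\<close> is identified with its set of edges.\<close>

definition is_spanning_tree :: "'a set \<Rightarrow> 'a set set \<Rightarrow> 'a set set \<Rightarrow> bool" where
  "is_spanning_tree V E F \<longleftrightarrow> F \<subseteq> E \<and> graph_tree V F"

text \<open>Only meaningful for connected finite graphs, where the minimum ranges over a finite
  nonempty set.\<close>

definition mst_length :: "'a set \<Rightarrow> 'a set set \<Rightarrow> ('a set \<Rightarrow> real) \<Rightarrow> real" where
  "mst_length V E c = Min ((\<lambda>F. sum c F) ` {F. is_spanning_tree V E F})"

end

theory Submission
  imports Defs
begin

text \<open>The example is a spider: \<open>m\<close> legs of total length slightly more than \<open>\<epsilon>\<close>, each consisting of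
  \<open>k\<close> equally short edges, leave a common centre, and the root is joined to every other vertex by an
  edge of length 1. The spider with one root edge is a spanning tree of length about \<open>1 + m * \<epsilon>\<close>.
  In a tree of depth at most \<open>1 + \<epsilon>\<close> the tip of a leg cannot be reached through the
  centre, so each leg needs a root edge of its own, and each of these replaces only one short edge.
  The total length is therefore about \<open>m * (1 + \<epsilon>)\<close>.\<close>

section \<open>Paths, connectivity and the number of edges\<close>

lemma graph_path_singleton: "v \<in> V \<Longrightarrow> graph_path V E [v]"
  by (simp add: graph_path_def)

lemma graph_path_prefix: "graph_path V E (p @ q) \<Longrightarrow> p \<noteq> [] \<Longrightarrow> graph_path V E p"
  by (auto simp: graph_path_def successively_append_iff)

lemma graph_path_snoc:
  "graph_path V E p \<Longrightarrow> v \<in> V \<Longrightarrow> v \<notin> set p \<Longrightarrow> {last p, v} \<in> E \<Longrightarrow> graph_path V E (p @ [v])"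
  by (auto simp: graph_path_def successively_append_iff)

text \<open>A path must not repeat vertices, so whenever the walk returns to a vertex already
  visited, the path is cut back to that vertex.\<close>

lemma rtranclp_imp_graph_path:
  assumes "\<forall>e\<in>E. e \<subseteq> V" "(\<lambda>x y. {x, y} \<in> E)\<^sup>*\<^sup>* u v" "u \<in> V"
  shows "\<exists>p. graph_path V E p \<and> hd p = u \<and> last p = v"
  using assms(2)
proof (induction rule: rtranclp_induct)
  case base
  then show ?case using assms(3) graph_path_singleton by force
next
  case (step y z)
  then obtain p where p: "graph_path V E p" "hd p = u" "last p = y" by blast
  have "p \<noteq> []" using p(1) by (simp add: graph_path_def)
  show ?case
  proof (cases "z \<in> set p")
    case True
    then obtain as bs where "p = (as @ [z]) @ bs" by (auto dest: split_list)
    moreover from this have "graph_path V E (as @ [z])"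
      using p(1) graph_path_prefix by blast
    ultimately show ?thesis using p(2)
      by (intro exI[of _ "as @ [z]"]) (auto simp: hd_append)
  next
    case False
    have "z \<in> V" using step(2) assms(1) by auto
    then have "graph_path V E (p @ [z])"
      using graph_path_snoc p False step(2) by metis
    then show ?thesis using p(2) \<open>p \<noteq> []\<close> by (intro exI[of _ "p @ [z]"]) auto
  qed
qed

lemma graph_connected_if_reachable:
  assumes "\<forall>e\<in>E. e \<subseteq> V" "r \<in> V" "\<And>v. v \<in> V \<Longrightarrow> (\<lambda>x y. {x, y} \<in> E)\<^sup>*\<^sup>* v r"
  shows "graph_connected V E"
proof -
  have "symp (\<lambda>x y. {x, y} \<in> E)" by (auto intro!: sympI simp: insert_commute)
  then have "(\<lambda>x y. {x, y} \<in> E)\<^sup>*\<^sup>* r v" if "v \<in> V" for v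
    using assms(3)[OF that] by (meson sympD symp_rtranclp)
  with assms(3) have "(\<lambda>x y. {x, y} \<in> E)\<^sup>*\<^sup>* u v" if "u \<in> V" "v \<in> V" for u v
    using that by (blast intro: rtranclp_trans)
  with rtranclp_imp_graph_path[OF assms(1)] assms(2) show ?thesis
    unfolding graph_connected_def by blast
qed

text \<open>Every vertex other than \<open>r\<close> is charged to the last edge of a shortest path from \<open>r\<close>.\<close>

lemma card_le_of_graph_connected:
  assumes "graph_connected V E" "finite E" "r \<in> V"
  shows "card (V - {r}) \<le> card E"
proof -
  define P where "P v p \<longleftrightarrow> graph_path V E p \<and> hd p = r \<and> last p = v" for v p
  define d where "d v = (LEAST n. \<exists>p. P v p \<and> length p = n)" for v
  have ex: "\<exists>u. {u, v} \<in> E \<and> d u < d v" if v: "v \<in> V - {r}" for v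
  proof -
    have "\<exists>n p. P v p \<and> length p = n"
      using assms(1,3) v by (auto simp: graph_connected_def P_def)
    then have "\<exists>p. P v p \<and> length p = d v"
      unfolding d_def by (rule LeastI_ex)
    then obtain p where p: "P v p" "length p = d v" by blast
    then have "p \<noteq> []" by (auto simp: P_def graph_path_def)
    then obtain q where q: "p = q @ [v]"
      using p(1) by (metis P_def append_butlast_last_id)
    with p(1) v have "q \<noteq> []" by (auto simp: P_def)
    have "P (last q) q" using p(1) q \<open>q \<noteq> []\<close> graph_path_prefix by (auto simp: P_def)
    then have "d (last q) \<le> length q" unfolding d_def by (intro Least_le) blast
    moreover have "{last q, v} \<in> E"
      using p(1) q \<open>q \<noteq> []\<close> by (auto simp: P_def graph_path_def successively_append_iff)
    ultimately show ?thesis using p(2) q by (intro exI[of _ "last q"]) auto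
  qed
  then obtain g where g: "\<And>v. v \<in> V - {r} \<Longrightarrow> {g v, v} \<in> E \<and> d (g v) < d v" by metis
  have "inj_on (\<lambda>v. {g v, v}) (V - {r})"
  proof (rule inj_onI, rule ccontr)
    \<comment> \<open>Two vertices charged to the same edge would precede each other, so each would
      be strictly closer to \<open>r\<close> than the other.\<close>
    fix v w assume *: "v \<in> V - {r}" "w \<in> V - {r}" "{g v, v} = {g w, w}" "v \<noteq> w"
    then have "g v = w" "g w = v" by (auto simp: doubleton_eq_iff)
    with g[OF *(1)] g[OF *(2)] show False by auto
  qed
  then show ?thesis
    using g by (intro card_inj_on_le[OF _ _ assms(2)]) auto
qed

section \<open>Trees given by a parent function\<close>

text \<open>Both neighbours of the largest vertex of a cycle would be its parent.\<close>

lemma no_graph_cycle_parent: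
  fixes E :: "'a::linorder set set"
  assumes parent: "\<And>x y. {x, y} \<in> E \<Longrightarrow> y \<le> x \<Longrightarrow> y = \<pi> x"
  shows "\<not> graph_cycle V E p"
proof
  assume "graph_cycle V E p"
  then have p: "distinct p" "successively (\<lambda>u v. {u, v} \<in> E) p" "length p \<ge> 3"
    "{last p, hd p} \<in> E" "p \<noteq> []"
    by (auto simp: graph_cycle_def graph_path_def)
  define x where "x = Max (set p)"
  have "x \<in> set p" and max: "\<And>y. y \<in> set p \<Longrightarrow> y \<le> x" using p(5) by (auto simp: x_def)
  then obtain as bs where split: "p = as @ x # bs" by (auto dest: split_list)
  have nb: "y = \<pi> x" if "{x, y} \<in> E \<or> {y, x} \<in> E" "y \<in> set p" for y
    using that parent[of x y] max by (auto simp: insert_commute)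
  have two: "hd q \<noteq> last q" if "distinct q" "length q \<ge> 2" for q :: "'a list"
    using that by (cases q) auto
  consider "as = []" | "bs = []" | "as \<noteq> []" "bs \<noteq> []" by blast
  then show False
  proof cases
    case 1
    then have "bs \<noteq> []" using p(3) split by auto
    then have "hd bs = \<pi> x" "last bs = \<pi> x"
      using 1 split p(2,4) by (simp_all add: nb successively_Cons)
    then show False using two[of bs] p(1,3) split 1 by simp
  next
    case 2
    then have "as \<noteq> []" using p(3) split by auto
    then have "hd as = \<pi> x" "last as = \<pi> x"
      using 2 split p(2,4) by (simp_all add: nb successively_append_iff)
    then show False using two[of as] p(1,3) split 2 by simp
  next
    case 3
    then have "last as = \<pi> x" "hd bs = \<pi> x"
      using split p(2) by (simp_all add: nb successively_append_iff successively_Cons)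
    moreover have "last as \<in> set as" "hd bs \<in> set bs" using 3 by auto
    ultimately show False using p(1) split by auto
  qed
qed

lemma graph_tree_parent:
  fixes V :: "'a::linorder set"
  assumes "finite V" "r \<in> V" "\<And>v. v \<in> V - {r} \<Longrightarrow> \<pi> v \<in> V \<and> \<pi> v < v"
  shows "graph_tree V ((\<lambda>v. {\<pi> v, v}) ` (V - {r}))" (is "graph_tree V ?E")
proof -
  have ug: "undirected_graph V ?E"
    using assms by (force simp: undirected_graph_def card_2_iff)
  have reach: "(\<lambda>x y. {x, y} \<in> ?E)\<^sup>*\<^sup>* v r" if "v \<in> V" for v
    using that
  \<comment> \<open>The type carries only a linear order; finiteness of \<open>V\<close> makes the
    number of smaller vertices a measure that drops from \<open>v\<close> to
    \<open>\<pi> v\<close>.\<close>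
  proof (induction "card {x\<in>V. x < v}" arbitrary: v rule: less_induct)
    case less
    show ?case
    proof (cases "v = r")
      case False
      then have \<pi>: "\<pi> v \<in> V" "\<pi> v < v" using assms(3) less.prems by auto
      then have "card {x\<in>V. x < \<pi> v} < card {x\<in>V. x < v}"
        using assms(1) by (intro psubset_card_mono) auto
      with less.hyps \<pi> have "(\<lambda>x y. {x, y} \<in> ?E)\<^sup>*\<^sup>* (\<pi> v) r" by blast
      moreover have "{v, \<pi> v} \<in> ?E" using False less.prems by (auto simp: insert_commute)
      ultimately show ?thesis by (rule converse_rtranclp_into_rtranclp[rotated])
    qed simp
  qed
  have conn: "graph_connected V ?E"
    using ug assms(2) reach by (intro graph_connected_if_reachable) (auto simp: undirected_graph_def)
  have parent: "y = \<pi> x" if "{x, y} \<in> ?E" "y \<le> x" for x y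
  proof -
    from that(1) obtain v where "v \<in> V - {r}" "{x, y} = {\<pi> v, v}" by blast
    then show ?thesis using that(2) assms(3)[of v] by (auto simp: doubleton_eq_iff)
  qed
  from ug conn no_graph_cycle_parent[OF parent] show ?thesis by (auto simp: graph_tree_def)
qed

lemma mst_length_le:
  assumes "undirected_graph V E" "is_spanning_tree V E T"
  shows "mst_length V E c \<le> sum c T"
proof -
  have "E \<subseteq> Pow V" "finite V" using assms(1) by (auto simp: undirected_graph_def)
  then have "finite (Pow E)" by (simp add: finite_subset)
  then have "finite {F. is_spanning_tree V E F}"
    by (rule rev_finite_subset) (auto simp: is_spanning_tree_def)
  then show ?thesis unfolding mst_length_def using assms(2) by (intro Min_le) auto
qed

section \<open>Lengths of paths\<close>

lemma path_length_Cons_Cons: "path_length c (u # v # p) = c {u, v} + path_length c (v # p)"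
  by (simp add: path_length_def path_edges_def)

lemma path_length_singleton: "path_length c [u] = 0"
  by (simp add: path_length_def path_edges_def)

lemma path_length_const:
  assumes "p \<noteq> []" "\<And>u v. u \<in> set p \<Longrightarrow> v \<in> set p \<Longrightarrow> c {u, v} = \<delta>"
  shows "path_length c p = \<delta> * real (length p - 1)"
  using assms
proof (induction p rule: induct_list012)
  case (3 u v p)
  then show ?case by (simp add: path_length_Cons_Cons algebra_simps)
qed (auto simp: path_length_singleton)

lemma successively_le_Suc_last:
  fixes f :: "'a \<Rightarrow> nat"
  assumes "successively (\<lambda>u v. f v \<le> Suc (f u)) p" "p \<noteq> []"
  shows "f (last p) \<le> f (hd p) + (length p - 1)"
  using assms by (induction p rule: induct_list012) auto

section \<open>The spider graph and its shallow spanning trees\<close>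

locale spider =
  fixes k m :: nat and \<delta> \<epsilon> :: real
  assumes k: "k > 0" and \<delta>: "0 < \<delta>" "\<delta> \<le> 1" and long: "\<delta> * real k > \<epsilon>"
begin

text \<open>The root is 0 and the centre is 1; leg \<open>i\<close> occupies the \<open>k\<close> numbers after \<open>1 + i * k\<close>,
  counted from the centre outwards.\<close>

definition V :: "nat set" where "V = {..m * k + 1}"

text \<open>The first vertex of leg \<open>i\<close> is \<open>2 + i * k\<close>, which the
  divisibility test detects. Truncated subtraction gives \<open>1 - 2 = 0\<close>, so the centre has
  to be treated before this test.\<close>

definition parent :: "nat \<Rightarrow> nat" where
  "parent v = (if v = 1 then 0 else if k dvd v - 2 then 1 else v - 1)"

definition T :: "nat set set" where "T = (\<lambda>v. {parent v, v}) ` (V - {0})"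

definition E :: "nat set set" where "E = T \<union> (\<lambda>v. {0, v}) ` (V - {0})"

definition c :: "nat set \<Rightarrow> real" where "c e = (if 0 \<in> e then 1 else \<delta>)"

definition leg :: "nat \<Rightarrow> nat set" where "leg i = {1 + i * k <.. 1 + Suc i * k}"

text \<open>This is the number of edges from the centre along leg \<open>i\<close>, with everything
  outside that leg collapsed to the centre.\<close>

definition pos :: "nat \<Rightarrow> nat \<Rightarrow> nat" where
  "pos i v = (if v \<in> leg i then v - (1 + i * k) else 0)"

lemma parent_less: "v \<in> V - {0} \<Longrightarrow> parent v \<in> V \<and> parent v < v"
  by (auto simp: parent_def V_def)

lemma graph: "undirected_graph V E"
proof -
  have "{parent v, v} \<subseteq> V \<and> card {parent v, v} = 2" "{0, v} \<subseteq> V \<and> card {0, v} = 2"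
    if "v \<in> V - {0}" for v
    using parent_less[OF that] that by (auto simp: V_def card_2_iff)
  then show ?thesis by (auto simp: undirected_graph_def E_def T_def V_def)
qed

lemma finite_E: "finite E"
  by (simp add: E_def T_def V_def)

lemma spanning_T: "is_spanning_tree V E T"
proof -
  have "graph_tree V T"
    unfolding T_def using parent_less by (intro graph_tree_parent) (auto simp: V_def)
  then show ?thesis by (auto simp: is_spanning_tree_def E_def)
qed

lemma sum_T: "sum c T = 1 + \<delta> * real (m * k)"
proof -
  have inj: "inj_on (\<lambda>v. {parent v, v}) (V - {0})"
  proof (rule inj_onI)
    fix v w assume "v \<in> V - {0}" "w \<in> V - {0}" "{parent v, v} = {parent w, w}"
    then show "v = w" using parent_less[of v] parent_less[of w] by (auto simp: doubleton_eq_iff)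
  qed
  have "sum c T = (\<Sum>v\<in>V - {0}. c {parent v, v})"
    unfolding T_def by (simp add: sum.reindex[OF inj])
  also have "V - {0} = insert 1 {2..m * k + 1}" by (auto simp: V_def)
  also have "(\<Sum>v\<in>\<dots>. c {parent v, v}) = 1 + (\<Sum>v\<in>{2..m * k + 1}. c {parent v, v})"
    by (simp add: c_def parent_def)
  also have "(\<Sum>v\<in>{2..m * k + 1}. c {parent v, v}) = (\<Sum>v\<in>{2..m * k + 1}. \<delta>)"
    by (intro sum.cong) (auto simp: c_def parent_def)
  finally show ?thesis by simp
qed

text \<open>The first vertex of a leg has position at most 1 and its parent, the centre, has
  position 0. Any other \<open>v\<close> lies in the same leg as \<open>v - 1\<close>.\<close>

lemma pos_parent:
  assumes "v \<ge> 2"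
  shows "pos i v \<le> Suc (pos i (parent v)) \<and> pos i (parent v) \<le> Suc (pos i v)"
proof (cases "k dvd v - 2")
  case True
  then obtain a where a: "v = 2 + k * a" using assms by (metis dvdE le_add_diff_inverse)
  have "a = i" if "v \<in> leg i"
  proof -
    have "i * k < Suc a * k" "a * k < Suc i * k" using that a k by (auto simp: leg_def algebra_simps)
    then have "i < Suc a" "a < Suc i" using k by (metis mult_less_cancel2)+
    then show ?thesis by simp
  qed
  then show ?thesis using True a assms by (auto simp: pos_def parent_def leg_def)
next
  case False
  \<comment> \<open>These are the only two values at which membership in \<open>leg i\<close>
    differs between \<open>v\<close> and \<open>v - 1\<close>.\<close>
  have "v - 2 \<noteq> i * k" "v - 2 \<noteq> Suc i * k" using False by (metis dvd_triv_right)+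
  then have "v - 1 \<in> leg i \<longleftrightarrow> v \<in> leg i" using assms by (auto simp: leg_def)
  moreover have "parent v = v - 1" using False assms by (simp add: parent_def)
  ultimately show ?thesis using assms by (auto simp: pos_def)
qed

lemma pos_edge:
  assumes "{u, v} \<in> E" "u \<noteq> 0" "v \<noteq> 0"
  shows "pos i v \<le> Suc (pos i u)"
proof -
  from assms have "{u, v} \<in> T" by (auto simp: E_def doubleton_eq_iff)
  then consider "u = parent v" | "v = parent u"
    by (auto simp: T_def doubleton_eq_iff)
  then show ?thesis
  proof cases
    case 1
    with assms have "v \<ge> 2" by (auto simp: parent_def split: if_splits)
    then show ?thesis using pos_parent 1 by simp
  next
    case 2
    with assms have "u \<ge> 2" by (auto simp: parent_def split: if_splits)
    then show ?thesis using pos_parent 2 by simp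
  qed
qed

text \<open>The path in \<open>F\<close> from the root to the tip of the leg leaves the root once
  and never returns. Had it entered the spider outside the leg, it would have to climb through all
  \<open>k\<close> positions, at a cost of at least \<open>1 + \<delta> * real k\<close>.\<close>

lemma root_edge_into_leg:
  assumes "is_spanning_tree V E F" "i < m"
    and short: "\<forall>p. graph_path V F p \<and> hd p = 0 \<longrightarrow> path_length c p \<le> 1 + \<epsilon>"
  shows "\<exists>v\<in>leg i. {0, v} \<in> F"
proof -
  define t where "t = 1 + Suc i * k"
  have "Suc i * k \<le> m * k" using assms(2) by (intro mult_right_mono) auto
  then have "t \<in> V" "0 \<in> V" by (auto simp: t_def V_def)
  with assms(1) obtain p where p: "graph_path V F p" "hd p = 0" "last p = t"
    unfolding is_spanning_tree_def graph_tree_def graph_connected_def by meson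
  have "F \<subseteq> E" using assms(1) by (simp add: is_spanning_tree_def)
  obtain v q where q: "p = 0 # v # q"
    using p by (cases p; cases "tl p") (auto simp: graph_path_def t_def)
  have path: "{0, v} \<in> F" "successively (\<lambda>u v. {u, v} \<in> F) (v # q)" "0 \<notin> set (v # q)"
    using p(1) q by (auto simp: graph_path_def)
  have "v \<in> leg i"
  proof (rule ccontr)
    assume "v \<notin> leg i"
    \<comment> \<open>Past the root the path uses spider edges only, and each raises the position by
      at most one.\<close>
    have "successively (\<lambda>u v. pos i v \<le> Suc (pos i u)) (v # q)"
      using path(2,3) \<open>F \<subseteq> E\<close> pos_edge
      by (intro successively_mono[OF path(2)]) (metis subsetD)+
    from successively_le_Suc_last[OF this]
    have "pos i t \<le> pos i v + length q" using p(3) q by simp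
    moreover have "pos i v = 0" using \<open>v \<notin> leg i\<close> by (simp add: pos_def)
    moreover have "pos i t = k" using k by (simp add: pos_def leg_def t_def)
    ultimately have "k \<le> length q" by simp
    have "path_length c (v # q) = \<delta> * real (length (v # q) - 1)"
      using path(3) by (intro path_length_const) (auto simp: c_def)
    then have "path_length c p = 1 + \<delta> * real (length q)"
      using q by (simp add: path_length_Cons_Cons c_def)
    moreover have "\<delta> * real k \<le> \<delta> * real (length q)" using \<open>k \<le> length q\<close> \<delta> by simp
    ultimately show False using short p long by force
  qed
  with path(1) show ?thesis by blast
qed

lemma leg_disjoint: "v \<in> leg i \<Longrightarrow> v \<in> leg j \<Longrightarrow> i = j"
proof -
  assume "v \<in> leg i" "v \<in> leg j"
  then have "i * k < Suc j * k" "j * k < Suc i * k" by (auto simp: leg_def)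
  then have "i < Suc j" "j < Suc i" by (metis mult_less_cancel2)+
  then show "i = j" by simp
qed

text \<open>Each edge costs \<open>\<delta>\<close>, plus a surcharge of \<open>1 - \<delta>\<close>
  if it meets the root. Connectivity forces at least \<open>m * k + 1\<close> edges, and the
  \<open>m\<close> disjoint legs force at least \<open>m\<close> surcharges.\<close>

lemma shallow_tree_length:
  assumes F: "is_spanning_tree V E F"
    and short: "\<forall>p. graph_path V F p \<and> hd p = 0 \<longrightarrow> path_length c p \<le> 1 + \<epsilon>"
  shows "sum c F \<ge> \<delta> * real (m * k + 1) + (1 - \<delta>) * real m"
proof -
  have "finite F" using F finite_E by (auto simp: is_spanning_tree_def intro: finite_subset)
  let ?R = "{e\<in>F. 0 \<in> e}"
  have "card (V - {0}) \<le> card F"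
    using F \<open>finite F\<close>
    by (intro card_le_of_graph_connected) (auto simp: is_spanning_tree_def graph_tree_def V_def)
  then have "m * k + 1 \<le> card F" by (simp add: V_def)
  have "\<forall>i<m. \<exists>v\<in>leg i. {0, v} \<in> F" using root_edge_into_leg[OF F _ short] by blast
  then obtain g where g: "\<And>i. i < m \<Longrightarrow> g i \<in> leg i \<and> {0, g i} \<in> F" by metis
  have "inj_on (\<lambda>i. {0, g i}) {..<m}"
    using g leg_disjoint by (intro inj_onI) (metis doubleton_eq_iff lessThan_iff)
  then have "card {..<m} \<le> card ?R"
    using g \<open>finite F\<close> by (intro card_inj_on_le) auto
  have "sum c F = (\<Sum>e\<in>F. \<delta> + (if 0 \<in> e then 1 - \<delta> else 0))"
    by (intro sum.cong) (auto simp: c_def)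
  also have "\<dots> = \<delta> * real (card F) + (1 - \<delta>) * real (card ?R)"
    using \<open>finite F\<close> by (simp add: sum.distrib sum.If_cases Int_def)
  finally show ?thesis
    using \<open>m * k + 1 \<le> card F\<close> \<open>card {..<m} \<le> card ?R\<close> \<delta>
    by (auto intro!: add_mono mult_left_mono simp del: of_nat_Suc of_nat_add)
qed

lemma graph_dist_root_le:
  assumes "v \<in> V"
  shows "graph_dist V E c 0 v \<le> 1"
proof -
  have "\<exists>p. graph_path V E p \<and> hd p = 0 \<and> last p = v \<and> path_length c p \<le> 1"
  proof (cases "v = 0")
    case True
    then show ?thesis
      using assms by (intro exI[of _ "[0]"]) (simp add: graph_path_singleton path_length_singleton)
  next
    case False
    then show ?thesis
      using assms
      by (intro exI[of _ "[0, v]"])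
        (auto simp: graph_path_def E_def V_def c_def path_length_Cons_Cons path_length_singleton)
  qed
  then obtain p where p: "graph_path V E p" "hd p = 0" "last p = v" "path_length c p \<le> 1"
    by blast
  then have "graph_dist V E c 0 v \<le> ereal (path_length c p)"
    unfolding graph_dist_def by (intro INF_lower) auto
  also have "\<dots> \<le> 1" using p(4) by simp
  finally show ?thesis .
qed

end

section \<open>Choice of the parameters\<close>

theorem theorem12:
  fixes \<epsilon> \<alpha> :: real
  assumes "\<epsilon> > 0" and "1 \<le> \<alpha>" and "\<alpha> < 1 + 1 / \<epsilon>"
  shows "\<exists>(V :: nat set) (E :: nat set set) (c :: nat set \<Rightarrow> real) (r :: nat).
           undirected_graph V E \<and> (\<forall>e\<in>E. c e > 0) \<and> r \<in> V \<and>
           (\<forall>v\<in>V. graph_dist V E c r v \<le> 1) \<and>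
           (\<forall>F. is_spanning_tree V E F \<and>
                (\<forall>p. graph_path V F p \<and> hd p = r \<longrightarrow> path_length c p \<le> 1 + \<epsilon>)
              \<longrightarrow> sum c F > \<alpha> * mst_length V E c)"
proof -
  have gap: "0 < 1 + \<epsilon> - \<alpha> * \<epsilon>" using assms by (simp add: field_simps)
  \<comment> \<open>The first bound makes the short edges cost at most 1. The second makes
    \<open>\<alpha> * \<delta>\<close> smaller than the gap, which thus stays positive when
    \<open>\<epsilon>\<close> is replaced by the true leg length
    \<open>\<epsilon> + \<delta>\<close>.\<close>
  obtain n :: nat where n: "real n > max \<epsilon> (\<alpha> * \<epsilon> / (1 + \<epsilon> - \<alpha> * \<epsilon>))"
    using reals_Archimedean2 by blast
  then have "n > 0" using assms(1) by (cases n) auto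
  define \<delta> where "\<delta> = \<epsilon> / real n"
  have \<delta>: "0 < \<delta>" "\<delta> \<le> 1" "\<delta> * real n = \<epsilon>"
    using n assms(1) \<open>n > 0\<close> by (auto simp: \<delta>_def)
  have "\<alpha> * \<epsilon> < real n * (1 + \<epsilon> - \<alpha> * \<epsilon>)" using n gap by (simp add: field_simps)
  then have "\<alpha> * \<delta> < 1 + \<epsilon> - \<alpha> * \<epsilon>" using \<open>n > 0\<close> by (simp add: \<delta>_def field_simps)
  then have gap': "0 < 1 + \<epsilon> - \<alpha> * (\<epsilon> + \<delta>)" by (simp add: algebra_simps)
  \<comment> \<open>The gap, gained once per leg, has to outweigh \<open>\<alpha>\<close> times the
    single root edge of \<open>T\<close>.\<close>
  obtain m :: nat where "real m > \<alpha> / (1 + \<epsilon> - \<alpha> * (\<epsilon> + \<delta>))"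
    using reals_Archimedean2 by blast
  then have m: "\<alpha> < real m * (1 + \<epsilon> - \<alpha> * (\<epsilon> + \<delta>))" using gap' by (simp add: pos_divide_less_eq)
  \<comment> \<open>Here \<open>n\<close> edges have length exactly \<open>\<epsilon>\<close>; one
    more makes each leg strictly longer.\<close>
  have leg: "\<delta> * real (Suc n) = \<epsilon> + \<delta>" using \<delta>(3) by (simp add: algebra_simps)
  interpret spider "Suc n" m \<delta> \<epsilon>
    using \<delta> leg by unfold_locales auto
  have prod: "\<delta> * real (m * Suc n) = real m * (\<epsilon> + \<delta>)"
    using leg by (metis mult.left_commute of_nat_mult)
  have "\<alpha> * mst_length V E c < sum c F"
    if F: "is_spanning_tree V E F"
      and short: "\<forall>p. graph_path V F p \<and> hd p = 0 \<longrightarrow> path_length c p \<le> 1 + \<epsilon>" for F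
  proof -
    have "\<alpha> * mst_length V E c \<le> \<alpha> * (1 + real m * (\<epsilon> + \<delta>))"
      using mst_length_le[OF graph spanning_T, of c] assms(2) unfolding sum_T prod
      by (intro mult_left_mono) auto
    \<comment> \<open>The right side equals \<open>real m * (1 + \<epsilon>) + \<delta>\<close>, so
      the choice of \<open>m\<close> gives the inequality.\<close>
    also have "\<dots> < real m * (\<epsilon> + \<delta>) + \<delta> + (1 - \<delta>) * real m"
      using m \<delta>(1) by (simp add: algebra_simps)
    also have "\<dots> = \<delta> * real (m * Suc n + 1) + (1 - \<delta>) * real m"
      unfolding of_nat_add distrib_left prod by simp
    also have "\<dots> \<le> sum c F" using shallow_tree_length[OF F short] .
    finally show ?thesis .
  qed
  moreover have "\<forall>e\<in>E. c e > 0" "0 \<in> V" using \<delta>(1) by (auto simp: c_def V_def)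
  ultimately show ?thesis
    using graph graph_dist_root_le by (intro exI[of _ V] exI[of _ E] exI[of _ c] exI[of _ 0]) blast
qed

end
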